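(* Let $(A,[,],\omega)$ be a symplectic left Alia algebra over $K$ and let $r=\sum_i a_i\otimes b_i\in A\otimes A$. Suppose that $(A,[,],\Delta_r)$ is a triangular left Alia bialgebra, where $\Delta_r(x)=\sum_i\big(([a_i,x]-[x,a_i])\otimes b_i-a_i\otimes[b_i,x]\big)$, and further that $(A,[,]_\omega,\Delta_r)$ is a dual triangular left Alia bialgebra, where, writing $\Delta_r(x)=x_{(1)}\otimes x_{(2)}$, $[x,y]_\omega=x_{(2)}\omega(x_{(1)},y)-x_{(1)}\omega(x_{(2)},y)-y_{(2)}\omega(x,y_{(1)})$. Then $((A,[,]),N)$ is a Nijenhuis left Alia algebra, where $N:A\to A$ is given by $N(x):=\sum_i\omega(x,a_i)b_i$ for $x\in A$.
   Context: All vector spaces are over a field $K$ of characteristic zero; Sweedler notation is used without summation sign. A left Alia algebra is $(A,[,])$ with $[,]$ bilinear and $[[x,y],z]+[[y,z],x]+[[z,x],y]=[[y,x],z]+[[z,y],x]+[[x,z],y]$. It is a Nijenhuis left Alia algebra with a linear map $N$ if $[N(x),N(y)]+N^2([x,y])=N([N(x),y]+[x,N(y)])$ for all $x,y$. A symplectic left Alia algebra $(A,[,],\omega)$ is a left Alia algebra with a skew-symmetric bilinear form $\omega\in(A\otimes A)^*$ such that $\omega([y,z]-[z,y],x)=\omega([x,y],z)-\omega([x,z],y)$ for all $x,y,z\in A$. A left Alia coalgebra is $(A,\Delta)$ with $\Delta:A\to A\otimes A$ linear and $$x_{(1)(2)}\otimes x_{(1)(1)}\otimes x_{(2)}+x_{(1)(1)}\otimes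 x_{(2)}\otimes x_{(1)(2)}+x_{(2)}\otimes x_{(1)(2)}\otimes x_{(1)(1)}=x_{(1)(1)}\otimes x_{(1)(2)}\otimes x_{(2)}+x_{(1)(2)}\otimes x_{(2)}\otimes x_{(1)(1)}+x_{(2)}\otimes x_{(1)(1)}\otimes x_{(1)(2)},$$ where $x_{(1)(1)}\otimes x_{(1)(2)}\otimes x_{(2)}=(\Delta\otimes\mathrm{id})\Delta(x)$. A left Alia bialgebra is $(A,[,],\Delta)$ with $(A,[,])$ a left Alia algebra, $(A,\Delta)$ a left Alia coalgebra and $(\tau-\mathrm{id}^{\otimes 2})(\Delta([x,y]-[y,x]))=(\tau-\mathrm{id}^{\otimes 2})((\mathcal R(y)\otimes\mathrm{id})\Delta(x)-(\mathcal R(x)\otimes\mathrm{id})\Delta(y))$, where $\mathcal R(y)z=[z,y]$ and $\tau$ is the flip. The left Alia Yang-Baxter equation in $(A,[,])$ for $r=\sum_i a_i\otimes b_i$ is $$\sum_{i,j}\big([a_i,a_j]\otimes b_i\otimes b_j+a_i\otimes([a_j,b_i]-[b_i,a_j])\otimes b_j-a_i\otimes a_j\otimes[b_j,b_i]\big)=0.$$ The left Alia bialgebra $(A,[,],\Delta_r)$ is triangular when $r$ is an antisymmetric ($r+\tau(r)=0$) solution of this equation. The co-left Alia Yang-Baxter equation in a left Alia coalgebra $(A,\Delta)$ for a bilinear form $\omega$ is $$\omega(x_{(1)},y)\omega(x_{(2)},z)+\omega(x,y_{(2)})\omega(y_{(1)},z)=\omega(x,y_{(1)})\omega(y_{(2)},z)+\omega(x,z_{(2)})\omega(y,z_{(1)})\quad\text{for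 all }x,y,z\in A.$$ The left Alia bialgebra $(A,[,]_\omega,\Delta)$ is dual triangular when $\omega$ is a skew-symmetric solution of the co-left Alia Yang-Baxter equation in $(A,\Delta)$. *)

theory Defs
  imports Complex_Main "HOL-Library.Poly_Mapping"
begin

section \<open>Tensor powers of a vector space\<close>

text \<open>
  A vector space over \<open>'k\<close> is a type \<open>'a\<close> together with a scalar multiplication \<open>scale\<close> satisfying
  \<^term>\<open>vector_space scale\<close>.  Its tensor square is the free \<open>'k\<close>-vector space on \<open>'a \<times> 'a\<close> modulo the
  span of the bilinearity relations, and similarly for the tensor cube.  As the relations depend on
  \<open>scale\<close>, no quotient type is formed: tensors are given by representatives in the free space
  (finitely supported functions), and equality of tensors is the congruence \<open>tens2_eq\<close>
  (resp. \<open>tens3_eq\<close>) modulo that span.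
\<close>

definition fscale :: "'k::field \<Rightarrow> ('b \<Rightarrow>\<^sub>0 'k) \<Rightarrow> ('b \<Rightarrow>\<^sub>0 'k)" where
  "fscale c t = Poly_Mapping.map ((*) c) t"

lemma lookup_fscale: "Poly_Mapping.lookup (fscale c t) p = c * Poly_Mapping.lookup t p"
  unfolding fscale_def by (transfer) (simp add: when_def)

lemma vector_space_fscale: "vector_space fscale"
  by unfold_locales
    (rule poly_mapping_eqI; simp add: lookup_fscale lookup_add algebra_simps)+

definition lin_ext :: "('k::field \<Rightarrow> 'v \<Rightarrow> 'v::ab_group_add) \<Rightarrow> ('b \<Rightarrow> 'v) \<Rightarrow> ('b \<Rightarrow>\<^sub>0 'k) \<Rightarrow> 'v" where
  "lin_ext s f t = (\<Sum>p\<in>Poly_Mapping.keys t. s (Poly_Mapping.lookup t p) (f p))"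

definition tens2 :: "'a \<Rightarrow> 'a \<Rightarrow> ('a \<times> 'a \<Rightarrow>\<^sub>0 'k::field)" where
  "tens2 x y = Poly_Mapping.single (x, y) 1"

definition tens3 :: "'a \<Rightarrow> 'a \<Rightarrow> 'a \<Rightarrow> ('a \<times> 'a \<times> 'a \<Rightarrow>\<^sub>0 'k::field)" where
  "tens3 x y z = Poly_Mapping.single (x, y, z) 1"

definition tens2_rels :: "('k::field \<Rightarrow> 'a \<Rightarrow> 'a::ab_group_add) \<Rightarrow> ('a \<times> 'a \<Rightarrow>\<^sub>0 'k) set" where
  "tens2_rels scale =
     {tens2 (x + x') y - tens2 x y - tens2 x' y | x x' y. True} \<union>
     {tens2 x (y + y') - tens2 x y - tens2 x y' | x y y'. True} \<union>
     {tens2 (scale c x) y - fscale c (tens2 x y) | c x y. True} \<union>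
     {tens2 x (scale c y) - fscale c (tens2 x y) | c x y. True}"

definition tens3_rels :: "('k::field \<Rightarrow> 'a \<Rightarrow> 'a::ab_group_add) \<Rightarrow> ('a \<times> 'a \<times> 'a \<Rightarrow>\<^sub>0 'k) set" where
  "tens3_rels scale =
     {tens3 (x + x') y z - tens3 x y z - tens3 x' y z | x x' y z. True} \<union>
     {tens3 x (y + y') z - tens3 x y z - tens3 x y' z | x y y' z. True} \<union>
     {tens3 x y (z + z') - tens3 x y z - tens3 x y z' | x y z z'. True} \<union>
     {tens3 (scale c x) y z - fscale c (tens3 x y z) | c x y z. True} \<union>
     {tens3 x (scale c y) z - fscale c (tens3 x y z) | c x y z. True} \<union>
     {tens3 x y (scale c z) - fscale c (tens3 x y z) | c x y z. True}"

definition tens2_eq ::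
  "('k::field \<Rightarrow> 'a \<Rightarrow> 'a::ab_group_add) \<Rightarrow> ('a \<times> 'a \<Rightarrow>\<^sub>0 'k) \<Rightarrow> ('a \<times> 'a \<Rightarrow>\<^sub>0 'k) \<Rightarrow> bool" where
  "tens2_eq scale t u \<longleftrightarrow> t - u \<in> module.span fscale (tens2_rels scale)"

definition tens3_eq ::
  "('k::field \<Rightarrow> 'a \<Rightarrow> 'a::ab_group_add) \<Rightarrow> ('a \<times> 'a \<times> 'a \<Rightarrow>\<^sub>0 'k) \<Rightarrow> ('a \<times> 'a \<times> 'a \<Rightarrow>\<^sub>0 'k) \<Rightarrow> bool" where
  "tens3_eq scale t u \<longleftrightarrow> t - u \<in> module.span fscale (tens3_rels scale)"

definition flip :: "('a \<times> 'a \<Rightarrow>\<^sub>0 'k::field) \<Rightarrow> ('a \<times> 'a \<Rightarrow>\<^sub>0 'k)" where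
  "flip = lin_ext fscale (\<lambda>(x, y). tens2 y x)"

text \<open>
  The map \<open>f \<otimes> id\<close> from the tensor square, for \<open>f\<close> with values in \<open>A\<close>, resp. in the tensor square
  of \<open>A\<close>.
\<close>

definition map_left :: "('a \<Rightarrow> 'a) \<Rightarrow> ('a \<times> 'a \<Rightarrow>\<^sub>0 'k::field) \<Rightarrow> ('a \<times> 'a \<Rightarrow>\<^sub>0 'k)" where
  "map_left f = lin_ext fscale (\<lambda>(x, y). tens2 (f x) y)"

definition comult_left ::
  "('a \<Rightarrow> ('a \<times> 'a \<Rightarrow>\<^sub>0 'k::field)) \<Rightarrow> ('a \<times> 'a \<Rightarrow>\<^sub>0 'k) \<Rightarrow> ('a \<times> 'a \<times> 'a \<Rightarrow>\<^sub>0 'k)" where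
  "comult_left D = lin_ext fscale (\<lambda>(x, y). lin_ext fscale (\<lambda>(u, v). tens3 u v y) (D x))"


section \<open>Left Alia algebras\<close>

definition bilinear_into ::
  "('k::field \<Rightarrow> 'a \<Rightarrow> 'a::ab_group_add) \<Rightarrow> ('k \<Rightarrow> 'v \<Rightarrow> 'v::ab_group_add) \<Rightarrow> ('a \<Rightarrow> 'a \<Rightarrow> 'v) \<Rightarrow> bool" where
  "bilinear_into scale s f \<longleftrightarrow>
     (\<forall>x. Vector_Spaces.linear scale s (\<lambda>y. f x y)) \<and>
     (\<forall>y. Vector_Spaces.linear scale s (\<lambda>x. f x y))"

locale left_alia_algebra = vector_space scale
  for scale :: "'k::field_char_0 \<Rightarrow> 'a::ab_group_add \<Rightarrow> 'a" +
  fixes br :: "'a \<Rightarrow> 'a \<Rightarrow> 'a"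
  assumes bilinear_br: "bilinear_into scale scale br"
    and alia: "br (br x y) z + br (br y z) x + br (br z x) y
             = br (br y x) z + br (br z y) x + br (br x z) y"

locale nijenhuis_left_alia_algebra = left_alia_algebra scale br
  for scale :: "'k::field_char_0 \<Rightarrow> 'a::ab_group_add \<Rightarrow> 'a" and br +
  fixes N :: "'a \<Rightarrow> 'a"
  assumes linear_N: "Vector_Spaces.linear scale scale N"
    and nijenhuis: "br (N x) (N y) + N (N (br x y)) = N (br (N x) y + br x (N y))"

definition skew_symmetric_form ::
  "('k::field \<Rightarrow> 'a \<Rightarrow> 'a::ab_group_add) \<Rightarrow> ('a \<Rightarrow> 'a \<Rightarrow> 'k) \<Rightarrow> bool" where
  "skew_symmetric_form scale \<omega> \<longleftrightarrow> bilinear_into scale (*) \<omega> \<and> (\<forall>x y. \<omega> x y = - \<omega> y x)"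

locale symplectic_left_alia_algebra = left_alia_algebra scale br
  for scale :: "'k::field_char_0 \<Rightarrow> 'a::ab_group_add \<Rightarrow> 'a" and br +
  fixes \<omega> :: "'a \<Rightarrow> 'a \<Rightarrow> 'k"
  assumes skew: "skew_symmetric_form scale \<omega>"
    and symplectic: "\<omega> (br y z - br z y) x = \<omega> (br x y) z - \<omega> (br x z) y"


section \<open>Left Alia coalgebras and bialgebras\<close>

text \<open>
  With \<open>(D \<otimes> id) (D x) = x\<^bsub>(1)(1)\<^esub> \<otimes> x\<^bsub>(1)(2)\<^esub> \<otimes> x\<^bsub>(2)\<^esub>\<close>, the variables \<open>u, v, w\<close> below stand for the
  components \<open>x\<^bsub>(1)(1)\<^esub>, x\<^bsub>(1)(2)\<^esub>, x\<^bsub>(2)\<^esub>\<close>.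
\<close>

locale left_alia_coalgebra = vector_space scale
  for scale :: "'k::field_char_0 \<Rightarrow> 'a::ab_group_add \<Rightarrow> 'a" +
  fixes D :: "'a \<Rightarrow> ('a \<times> 'a \<Rightarrow>\<^sub>0 'k)"
  assumes comult_add: "tens2_eq scale (D (x + y)) (D x + D y)"
    and comult_scale: "tens2_eq scale (D (scale c x)) (fscale c (D x))"
    and coalia: "tens3_eq scale
        (lin_ext fscale (\<lambda>(u, v, w). tens3 v u w + tens3 u w v + tens3 w v u) (comult_left D (D x)))
        (lin_ext fscale (\<lambda>(u, v, w). tens3 u v w + tens3 v w u + tens3 w u v) (comult_left D (D x)))"

locale left_alia_bialgebra = left_alia_algebra scale br + left_alia_coalgebra scale D
  for scale :: "'k::field_char_0 \<Rightarrow> 'a::ab_group_add \<Rightarrow> 'a" and br D +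
  assumes compatible: "tens2_eq scale
        (flip (D (br x y - br y x)) - D (br x y - br y x))
        (flip (map_left (\<lambda>z. br z y) (D x) - map_left (\<lambda>z. br z x) (D y))
          - (map_left (\<lambda>z. br z y) (D x) - map_left (\<lambda>z. br z x) (D y)))"


section \<open>Triangular and dual triangular left Alia bialgebras\<close>

text \<open>
  A tensor \<open>r = \<Sum>\<^sub>i a\<^sub>i \<otimes> b\<^sub>i\<close> is given by a finite index set \<open>I\<close> and families \<open>a\<close>, \<open>b\<close>.
\<close>

definition tensor_sum :: "'i set \<Rightarrow> ('i \<Rightarrow> 'a) \<Rightarrow> ('i \<Rightarrow> 'a) \<Rightarrow> ('a \<times> 'a \<Rightarrow>\<^sub>0 'k::field)" where
  "tensor_sum I a b = (\<Sum>i\<in>I. tens2 (a i) (b i))"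

definition comult_r ::
  "('a::ab_group_add \<Rightarrow> 'a \<Rightarrow> 'a) \<Rightarrow> 'i set \<Rightarrow> ('i \<Rightarrow> 'a) \<Rightarrow> ('i \<Rightarrow> 'a) \<Rightarrow> 'a \<Rightarrow> ('a \<times> 'a \<Rightarrow>\<^sub>0 'k::field)" where
  "comult_r br I a b x =
     (\<Sum>i\<in>I. tens2 (br (a i) x - br x (a i)) (b i) - tens2 (a i) (br (b i) x))"

definition left_alia_YBE ::
  "('k::field \<Rightarrow> 'a \<Rightarrow> 'a::ab_group_add) \<Rightarrow> ('a \<Rightarrow> 'a \<Rightarrow> 'a) \<Rightarrow> 'i set \<Rightarrow> ('i \<Rightarrow> 'a) \<Rightarrow> ('i \<Rightarrow> 'a) \<Rightarrow> bool" where
  "left_alia_YBE scale br I a b \<longleftrightarrow> tens3_eq scale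
     (\<Sum>i\<in>I. \<Sum>j\<in>I. tens3 (br (a i) (a j)) (b i) (b j)
                  + tens3 (a i) (br (a j) (b i) - br (b i) (a j)) (b j)
                  - tens3 (a i) (a j) (br (b j) (b i))) 0"

definition antisymmetric_tensor ::
  "('k::field \<Rightarrow> 'a \<Rightarrow> 'a::ab_group_add) \<Rightarrow> ('a \<times> 'a \<Rightarrow>\<^sub>0 'k) \<Rightarrow> bool" where
  "antisymmetric_tensor scale r \<longleftrightarrow> tens2_eq scale (r + flip r) 0"

definition triangular_left_alia_bialgebra ::
  "('k::field_char_0 \<Rightarrow> 'a \<Rightarrow> 'a::ab_group_add) \<Rightarrow> ('a \<Rightarrow> 'a \<Rightarrow> 'a) \<Rightarrow> 'i set \<Rightarrow> ('i \<Rightarrow> 'a) \<Rightarrow> ('i \<Rightarrow> 'a) \<Rightarrow> bool" where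
  "triangular_left_alia_bialgebra scale br I a b \<longleftrightarrow>
     left_alia_bialgebra scale br (comult_r br I a b) \<and>
     antisymmetric_tensor scale (tensor_sum I a b) \<and>
     left_alia_YBE scale br I a b"

text \<open>
  The co-left Alia Yang-Baxter equation; \<open>(p, q)\<close> stands for \<open>(x\<^bsub>(1)\<^esub>, x\<^bsub>(2)\<^esub>)\<close>, and likewise for
  \<open>y\<close> and \<open>z\<close>.
\<close>

definition co_left_alia_YBE ::
  "('a \<Rightarrow> ('a \<times> 'a \<Rightarrow>\<^sub>0 'k::field)) \<Rightarrow> ('a \<Rightarrow> 'a \<Rightarrow> 'k) \<Rightarrow> bool" where
  "co_left_alia_YBE D \<omega> \<longleftrightarrow> (\<forall>x y z.
     lin_ext (*) (\<lambda>(p, q). \<omega> p y * \<omega> q z) (D x) + lin_ext (*) (\<lambda>(p, q). \<omega> x q * \<omega> p z) (D y)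
   = lin_ext (*) (\<lambda>(p, q). \<omega> x p * \<omega> q z) (D y) + lin_ext (*) (\<lambda>(p, q). \<omega> x q * \<omega> y p) (D z))"

definition br_form ::
  "('k::field \<Rightarrow> 'a \<Rightarrow> 'a::ab_group_add) \<Rightarrow> ('a \<Rightarrow> ('a \<times> 'a \<Rightarrow>\<^sub>0 'k)) \<Rightarrow> ('a \<Rightarrow> 'a \<Rightarrow> 'k) \<Rightarrow> 'a \<Rightarrow> 'a \<Rightarrow> 'a" where
  "br_form scale D \<omega> x y =
     lin_ext scale (\<lambda>(p, q). scale (\<omega> p y) q) (D x)
   - lin_ext scale (\<lambda>(p, q). scale (\<omega> q y) p) (D x)
   - lin_ext scale (\<lambda>(p, q). scale (\<omega> x p) q) (D y)"

definition dual_triangular_left_alia_bialgebra ::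
  "('k::field_char_0 \<Rightarrow> 'a \<Rightarrow> 'a::ab_group_add) \<Rightarrow> ('a \<Rightarrow> ('a \<times> 'a \<Rightarrow>\<^sub>0 'k)) \<Rightarrow> ('a \<Rightarrow> 'a \<Rightarrow> 'k) \<Rightarrow> bool" where
  "dual_triangular_left_alia_bialgebra scale D \<omega> \<longleftrightarrow>
     left_alia_bialgebra scale (br_form scale D \<omega>) D \<and>
     skew_symmetric_form scale \<omega> \<and>
     co_left_alia_YBE D \<omega>"

end

theory Submission
  imports Defs
begin

text \<open>
  Contracting tensors with the form turns both Yang-Baxter equations into identities for the
  operator \<open>N = r\<^sup># \<circ> \<omega>\<^sup>\<flat>\<close>, where \<open>\<omega>\<^sup>\<flat> x = \<omega>(x, \<cdot>)\<close> and \<open>r\<^sup># f = \<Sum>\<^sub>i f(a\<^sub>i) b\<^sub>i\<close>.  Antisymmetry of \<open>r\<close>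
  together with skew-symmetry of \<open>\<omega>\<close> says that \<open>N\<close> is self-adjoint for \<open>\<omega>\<close>.

  Contracting the left Alia Yang-Baxter equation with \<open>\<omega>\<^sup>\<flat> y\<close> and \<open>\<omega>\<^sup>\<flat> x\<close> in the first two factors
  and then using that \<open>\<omega>\<close> is symplectic yields
  \<open>[N x, N y] = N [x, N y] + \<Sum>\<^sub>j (\<omega>([N x, a\<^sub>j], y) - \<omega>([x, a\<^sub>j], N y)) b\<^sub>j\<close>
  (\<open>YBE_contracted\<close>).  As \<open>N\<^sup>2 z = \<Sum>\<^sub>j \<omega>(z, N a\<^sub>j) b\<^sub>j\<close> by self-adjointness, the Nijenhuis identity
  follows if the sum equals \<open>N [N x, y] - N\<^sup>2 [x, y]\<close>, and for this it is enough that
  \<open>\<omega>([N x, y], z) - \<omega>([N x, z], y) = \<omega>([x, y], N z) - \<omega>([x, z], N y)\<close> for \<open>z = a\<^sub>j\<close>.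
  For all \<open>x, y, z\<close>, that identity is precisely the co-left Alia Yang-Baxter equation for \<open>\<Delta>\<^sub>r\<close>,
  once the symplectic condition has been used twice (\<open>coYBE_contracted\<close>).\<close>

section \<open>Linear extension and universal properties of the tensor powers\<close>

lemma lin_ext_superset:
  assumes "vector_space s" "finite S" "Poly_Mapping.keys t \<subseteq> S"
  shows "lin_ext s f t = (\<Sum>p\<in>S. s (Poly_Mapping.lookup t p) (f p))"
proof -
  interpret vector_space s by fact
  show ?thesis
    unfolding lin_ext_def using assms(2,3)
    by (intro sum.mono_neutral_left) (auto simp: in_keys_iff)
qed

lemma linear_lin_ext:
  assumes "vector_space s"
  shows "Vector_Spaces.linear fscale s (lin_ext s f)"
proof -
  interpret vector_space s by fact
  have "lin_ext s f (t + u) = lin_ext s f t + lin_ext s f u" for t u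
  proof -
    let ?S = "Poly_Mapping.keys t \<union> Poly_Mapping.keys u"
    have "Poly_Mapping.keys (t + u) \<subseteq> ?S" by (rule keys_add)
    then show ?thesis
      by (simp add: lin_ext_superset[OF assms, of ?S] lookup_add scale_left_distrib sum.distrib)
  qed
  moreover have "lin_ext s f (fscale c t) = s c (lin_ext s f t)" for c t
  proof -
    have "Poly_Mapping.keys (fscale c t) \<subseteq> Poly_Mapping.keys t"
      by (auto simp: in_keys_iff lookup_fscale)
    then show ?thesis
      by (simp add: lin_ext_superset[OF assms, of "Poly_Mapping.keys t"] lookup_fscale scale_sum_right)
  qed
  ultimately show ?thesis
    using assms vector_space_fscale by (simp add: Vector_Spaces.linear_iff)
qed

lemma lin_ext_single_one:
  assumes "vector_space s"
  shows "lin_ext s f (Poly_Mapping.single p 1) = f p"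
proof -
  interpret vector_space s by fact
  show ?thesis by (simp add: lin_ext_def)
qed

lemma lin_ext_tens2: "vector_space s \<Longrightarrow> lin_ext s f (tens2 x y) = f (x, y)"
  by (simp add: tens2_def lin_ext_single_one)

lemma lin_ext_tens3: "vector_space s \<Longrightarrow> lin_ext s f (tens3 x y z) = f (x, y, z)"
  by (simp add: tens3_def lin_ext_single_one)

lemma bilinear_intoD:
  assumes "bilinear_into scale s f"
  shows "f (x + x') y = f x y + f x' y" "f x (y + y') = f x y + f x y'"
    "f (scale c x) y = s c (f x y)" "f x (scale c y) = s c (f x y)"
    "f (x - x') y = f x y - f x' y" "f x (y - y') = f x y - f x y'"
    "f (- x) y = - f x y" "f x (- y) = - f x y"
    "f (sum g A) y = (\<Sum>i\<in>A. f (g i) y)" "f x (sum g A) = (\<Sum>i\<in>A. f x (g i))"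
proof -
  have l: "module_hom scale s (\<lambda>x. f x y)" and r: "module_hom scale s (\<lambda>y. f x y)" for x y
    using assms by (simp_all add: bilinear_into_def module_hom_iff_linear)
  show "f (x + x') y = f x y + f x' y" "f (scale c x) y = s c (f x y)"
    "f (x - x') y = f x y - f x' y" "f (- x) y = - f x y"
    "f (sum g A) y = (\<Sum>i\<in>A. f (g i) y)"
    using module_hom.add[OF l] module_hom.scale[OF l] module_hom.diff[OF l] module_hom.neg[OF l]
      module_hom.sum[OF l] by auto
  show "f x (y + y') = f x y + f x y'" "f x (scale c y) = s c (f x y)"
    "f x (y - y') = f x y - f x y'" "f x (- y) = - f x y"
    "f x (sum g A) = (\<Sum>i\<in>A. f x (g i))"
    using module_hom.add[OF r] module_hom.scale[OF r] module_hom.diff[OF r] module_hom.neg[OF r]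
      module_hom.sum[OF r] by auto
qed

text \<open>
  The linear extension of a bilinear map vanishes on the relations, hence on their span; this is
  how a congruence of representatives is turned into an equation between vectors.
\<close>

lemma lin_ext_tens2_eq:
  assumes s: "vector_space s" and f: "bilinear_into scale s f" and eq: "tens2_eq scale t u"
  shows "lin_ext s (\<lambda>(x, y). f x y) t = lin_ext s (\<lambda>(x, y). f x y) u"
proof -
  let ?F = "lin_ext s (\<lambda>(x, y). f x y)"
  interpret F: module_hom fscale s ?F
    using linear_lin_ext[OF s] by (simp add: module_hom_iff_linear)
  have "?F v = 0" if "v \<in> tens2_rels scale" for v
    using that
    by (auto simp: tens2_rels_def F.diff F.scale lin_ext_tens2[OF s] bilinear_intoD[OF f])
  then have "?F (t - u) = 0"
    using eq unfolding tens2_eq_def by (rule F.eq_0_on_span)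
  then show ?thesis by (simp add: F.diff)
qed

lemma lin_ext_tens3_eq:
  assumes s: "vector_space s"
    and f1: "\<And>y z. Vector_Spaces.linear scale s (\<lambda>x. f x y z)"
    and f2: "\<And>x z. Vector_Spaces.linear scale s (\<lambda>y. f x y z)"
    and f3: "\<And>x y. Vector_Spaces.linear scale s (\<lambda>z. f x y z)"
    and eq: "tens3_eq scale t u"
  shows "lin_ext s (\<lambda>(x, y, z). f x y z) t = lin_ext s (\<lambda>(x, y, z). f x y z) u"
proof -
  let ?F = "lin_ext s (\<lambda>(x, y, z). f x y z)"
  interpret F: module_hom fscale s ?F
    using linear_lin_ext[OF s] by (simp add: module_hom_iff_linear)
  have "?F v = 0" if "v \<in> tens3_rels scale" for v
    using that f1 f2 f3
    by (auto simp: tens3_rels_def F.diff F.scale lin_ext_tens3[OF s] Vector_Spaces.linear_iff)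
  then have "?F (t - u) = 0"
    using eq unfolding tens3_eq_def by (rule F.eq_0_on_span)
  then show ?thesis by (simp add: F.diff)
qed

lemma antisymmetric_tensor_sum_swap:
  fixes scale :: "'k::field \<Rightarrow> 'a::ab_group_add \<Rightarrow> 'a"
  assumes s: "vector_space s" and f: "bilinear_into scale s f"
    and r: "antisymmetric_tensor scale (tensor_sum I a b)"
  shows "(\<Sum>i\<in>I. f (b i) (a i)) = - (\<Sum>i\<in>I. f (a i) (b i))"
proof -
  let ?F = "lin_ext s (\<lambda>(x, y). f x y)"
  interpret F: module_hom fscale s ?F
    using linear_lin_ext[OF s] by (simp add: module_hom_iff_linear)
  interpret flip: module_hom fscale fscale flip
    unfolding flip_def using linear_lin_ext[OF vector_space_fscale]
    by (simp add: module_hom_iff_linear)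
  have "flip (tens2 x y) = (tens2 y x :: 'a \<times> 'a \<Rightarrow>\<^sub>0 'k)" for x y
    by (simp add: flip_def lin_ext_tens2[OF vector_space_fscale])
  moreover have "?F (tensor_sum I a b + flip (tensor_sum I a b)) = ?F 0"
    using r by (intro lin_ext_tens2_eq[OF s f]) (simp add: antisymmetric_tensor_def)
  ultimately have "(\<Sum>i\<in>I. f (a i) (b i)) + (\<Sum>i\<in>I. f (b i) (a i)) = 0"
    by (simp add: tensor_sum_def F.add F.sum flip.sum F.zero lin_ext_tens2[OF s])
  then show ?thesis by (simp add: eq_neg_iff_add_eq_0 add.commute)
qed


section \<open>The operator of a form and an antisymmetric tensor\<close>

locale symplectic_left_alia_algebra_tensor = symplectic_left_alia_algebra scale br \<omega>
  for scale :: "'k::field_char_0 \<Rightarrow> 'a::ab_group_add \<Rightarrow> 'a" and br and \<omega> :: "'a \<Rightarrow> 'a \<Rightarrow> 'k" +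
  fixes I :: "'i set" and a b :: "'i \<Rightarrow> 'a"
  assumes antisym: "antisymmetric_tensor scale (tensor_sum I a b)"
begin

definition N :: "'a \<Rightarrow> 'a" where
  "N x = (\<Sum>i\<in>I. scale (\<omega> x (a i)) (b i))"

lemma vs: "vector_space scale"
  by unfold_locales

lemma bilinear_form: "bilinear_into scale (*) \<omega>"
  using skew unfolding skew_symmetric_form_def by blast

lemma form_skew: "\<omega> x y = - \<omega> y x"
  using skew unfolding skew_symmetric_form_def by blast

lemmas br_simps = bilinear_intoD[OF bilinear_br]
lemmas form_simps = bilinear_intoD[OF bilinear_form]

lemma linear_N: "Vector_Spaces.linear scale scale N"
  by (simp add: Vector_Spaces.linear_iff vs N_def form_simps scale_left_distrib sum.distrib
      scale_sum_right)

lemma N_add: "N (x + y) = N x + N y"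
  using linear_N by (simp add: Vector_Spaces.linear_iff)

text \<open>
  Contracting the second factor of \<open>r\<close> instead of the first changes only the sign, as \<open>r\<close> is
  antisymmetric.
\<close>

lemma contract_second: "(\<Sum>i\<in>I. scale (\<omega> x (b i)) (a i)) = - N x"
proof -
  have "bilinear_into scale scale (\<lambda>u v. scale (\<omega> x u) v)"
    by (simp add: bilinear_into_def Vector_Spaces.linear_iff vs form_simps scale_left_distrib
        scale_right_distrib mult.commute)
  from antisymmetric_tensor_sum_swap[OF vs this antisym] show ?thesis
    by (simp add: N_def)
qed

lemma contract_second_left: "(\<Sum>i\<in>I. scale (\<omega> (b i) x) (a i)) = N x"
  using contract_second[of x] by (simp add: form_skew[of _ x] sum_negf)

lemma N_self_adjoint: "\<omega> (N x) y = \<omega> x (N y)"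
proof -
  have "\<omega> (N x) y = (\<Sum>i\<in>I. \<omega> x (a i) * \<omega> (b i) y)"
    by (simp add: N_def form_simps)
  also have "\<dots> = \<omega> x (\<Sum>i\<in>I. scale (\<omega> (b i) y) (a i))"
    by (simp add: form_simps mult.commute)
  finally show ?thesis by (simp add: contract_second_left)
qed


section \<open>Contracting the two Yang-Baxter equations\<close>

text \<open>
  With \<open>\<omega>(y, \<cdot>)\<close> and \<open>\<omega>(x, \<cdot>)\<close> in the first two factors, the last term of the equation becomes
  \<open>- [N x, N y]\<close>; the symplectic condition splits \<open>N [x, N y]\<close> off the middle term.
\<close>

lemma YBE_contracted:
  assumes "left_alia_YBE scale br I a b"
  shows "br (N x) (N y) =
    N (br x (N y)) + (\<Sum>j\<in>I. scale (\<omega> (br (N x) (a j)) y - \<omega> (br x (a j)) (N y)) (b j))"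
proof -
  let ?f = "\<lambda>u v w. scale (\<omega> y u * \<omega> x v) w"
  let ?F = "lin_ext scale (\<lambda>(u, v, w). ?f u v w)"
  interpret F: module_hom fscale scale ?F
    using linear_lin_ext[OF vs] by (simp add: module_hom_iff_linear)
  have "?F (\<Sum>i\<in>I. \<Sum>j\<in>I. tens3 (br (a i) (a j)) (b i) (b j)
                  + tens3 (a i) (br (a j) (b i) - br (b i) (a j)) (b j)
                  - tens3 (a i) (a j) (br (b j) (b i))) = ?F 0"
    using assms unfolding left_alia_YBE_def
    by (intro lin_ext_tens3_eq[OF vs])
      (simp_all add: Vector_Spaces.linear_iff vs form_simps algebra_simps scale_left_distrib
        scale_right_distrib)
  then have "(\<Sum>i\<in>I. \<Sum>j\<in>I. ?f (br (a i) (a j)) (b i) (b j))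
      + (\<Sum>i\<in>I. \<Sum>j\<in>I. ?f (a i) (br (a j) (b i) - br (b i) (a j)) (b j))
      - (\<Sum>i\<in>I. \<Sum>j\<in>I. ?f (a i) (a j) (br (b j) (b i))) = 0"
    by (simp add: F.sum F.add F.diff F.zero lin_ext_tens3[OF vs] sum.distrib sum_subtractf)
  moreover have "(\<Sum>i\<in>I. \<Sum>j\<in>I. ?f (br (a i) (a j)) (b i) (b j))
      = (\<Sum>j\<in>I. scale (\<omega> (br (N x) (a j)) y) (b j))"
  proof -
    have "(\<Sum>i\<in>I. \<omega> y (br (a i) (a j)) * \<omega> x (b i)) = \<omega> (br (N x) (a j)) y" for j
    proof -
      have "(\<Sum>i\<in>I. \<omega> y (br (a i) (a j)) * \<omega> x (b i))
          = \<omega> y (br (\<Sum>i\<in>I. scale (\<omega> x (b i)) (a i)) (a j))"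
        by (simp add: br_simps form_simps mult.commute)
      then show ?thesis
        by (simp add: contract_second br_simps form_simps form_skew[of y])
    qed
    then show ?thesis
      by (subst sum.swap) (simp flip: scale_sum_left)
  qed
  moreover have "(\<Sum>i\<in>I. \<Sum>j\<in>I. ?f (a i) (br (a j) (b i) - br (b i) (a j)) (b j))
      = N (br x (N y)) - (\<Sum>j\<in>I. scale (\<omega> (br x (a j)) (N y)) (b j))"
  proof -
    have "(\<Sum>i\<in>I. \<omega> y (a i) * \<omega> x (br (a j) (b i) - br (b i) (a j)))
        = \<omega> (br x (N y)) (a j) - \<omega> (br x (a j)) (N y)" for j
    proof -
      have "(\<Sum>i\<in>I. \<omega> y (a i) * \<omega> x (br (a j) (b i) - br (b i) (a j)))
          = \<omega> x (br (a j) (N y) - br (N y) (a j))"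
        by (simp add: N_def br_simps form_simps right_diff_distrib sum_subtractf)
      also have "\<dots> = - \<omega> (br (a j) (N y) - br (N y) (a j)) x"
        by (rule form_skew)
      finally show ?thesis by (simp add: symplectic)
    qed
    then show ?thesis
      by (subst sum.swap)
        (simp add: N_def[of "br x (N y)"] sum_subtractf scale_left_diff_distrib flip: scale_sum_left)
  qed
  moreover have "(\<Sum>i\<in>I. \<Sum>j\<in>I. ?f (a i) (a j) (br (b j) (b i))) = br (N x) (N y)"
    by (simp add: N_def br_simps scale_sum_right)
  ultimately show ?thesis
    by (simp add: scale_left_diff_distrib sum_subtractf algebra_simps)
qed

text \<open>
  One formula serves all four terms of the co-left Alia Yang-Baxter equation, since by
  skew-symmetry each of them is, up to sign, a contraction of this shape.
\<close>

lemma comult_r_contracted: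
  "lin_ext (*) (\<lambda>(p, q). \<omega> u p * \<omega> v q) (comult_r br I a b x)
    = - \<omega> u (br (N v) x - br x (N v)) - \<omega> v (br (N u) x)"
proof -
  have s: "vector_space ((*) :: 'k \<Rightarrow> 'k \<Rightarrow> 'k)"
    by unfold_locales (simp_all add: algebra_simps)
  interpret F: module_hom fscale "(*)" "lin_ext (*) (\<lambda>(p, q). \<omega> u p * \<omega> v q)"
    using linear_lin_ext[OF s] by (simp add: module_hom_iff_linear)
  have "lin_ext (*) (\<lambda>(p, q). \<omega> u p * \<omega> v q) (comult_r br I a b x)
      = (\<Sum>i\<in>I. \<omega> u (br (a i) x - br x (a i)) * \<omega> v (b i))
        - (\<Sum>i\<in>I. \<omega> u (a i) * \<omega> v (br (b i) x))"
    by (simp add: comult_r_def F.sum F.diff lin_ext_tens2[OF s] sum_subtractf)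
  also have "(\<Sum>i\<in>I. \<omega> u (br (a i) x - br x (a i)) * \<omega> v (b i))
      = (let m = \<Sum>i\<in>I. scale (\<omega> v (b i)) (a i) in \<omega> u (br m x - br x m))"
    by (simp add: br_simps form_simps right_diff_distrib sum_subtractf mult.commute)
  also have "\<dots> = - \<omega> u (br (N v) x - br x (N v))"
    by (simp add: contract_second br_simps form_simps)
  also have "(\<Sum>i\<in>I. \<omega> u (a i) * \<omega> v (br (b i) x)) = \<omega> v (br (N u) x)"
    by (simp add: N_def br_simps form_simps)
  finally show ?thesis .
qed

text \<open>
  After all arguments of \<open>\<omega>\<close> are put in the order that has the bracket first, two pairs of terms
  remain to be rewritten by the symplectic condition; everything that does not appear in the
  conclusion then cancels.
\<close>

lemma coYBE_contracted:
  assumes "co_left_alia_YBE (comult_r br I a b) \<omega>"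
  shows "\<omega> (br (N x) y) z - \<omega> (br (N x) z) y = \<omega> (br x y) (N z) - \<omega> (br x z) (N y)"
proof -
  let ?C = "\<lambda>u v. lin_ext (*) (\<lambda>(p, q). \<omega> u p * \<omega> v q)"
  let ?D = "comult_r br I a b"
  have neg: "lin_ext (*) (\<lambda>(p, q). - f p q) t = - lin_ext (*) (\<lambda>(p, q). f p q) t"
    for f :: "'a \<Rightarrow> 'a \<Rightarrow> 'k" and t
    by (simp add: lin_ext_def sum_negf split_beta)
  \<comment> \<open>The claim is the equation with its first two arguments exchanged.\<close>
  have "lin_ext (*) (\<lambda>(p, q). \<omega> p x * \<omega> q z) (?D y) + lin_ext (*) (\<lambda>(p, q). \<omega> y q * \<omega> p z) (?D x)
      = lin_ext (*) (\<lambda>(p, q). \<omega> y p * \<omega> q z) (?D x) + lin_ext (*) (\<lambda>(p, q). \<omega> y q * \<omega> x p) (?D z)"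
    using assms by (simp add: co_left_alia_YBE_def)
  then have "?C x z (?D y) - ?C z y (?D x) = - ?C y z (?D x) + ?C x y (?D z)"
    by (simp add: form_skew[of _ x] form_skew[of _ z] neg mult.commute)
  then have "\<omega> (br (N z) y) x - \<omega> (br y (N z)) x + \<omega> (br (N x) y) z
      - (\<omega> (br (N y) x) z - \<omega> (br x (N y)) z + \<omega> (br (N z) x) y)
    = - (\<omega> (br (N z) x) y - \<omega> (br x (N z)) y + \<omega> (br (N y) x) z)
      + (\<omega> (br (N y) z) x - \<omega> (br z (N y)) x + \<omega> (br (N x) z) y)"
    unfolding comult_r_contracted
    by (simp add: form_simps form_skew[of x "br _ _"] form_skew[of y "br _ _"]
        form_skew[of z "br _ _"])
  moreover have "\<omega> (br (N z) y) x - \<omega> (br y (N z)) x = \<omega> (br x (N z)) y - \<omega> (br x y) (N z)"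
    using symplectic[of "N z" y x] by (simp add: form_simps)
  moreover have "\<omega> (br (N y) z) x - \<omega> (br z (N y)) x = \<omega> (br x (N y)) z - \<omega> (br x z) (N y)"
    using symplectic[of "N y" z x] by (simp add: form_simps)
  ultimately show ?thesis by algebra
qed

lemma nijenhuis_N:
  assumes "left_alia_YBE scale br I a b" and "co_left_alia_YBE (comult_r br I a b) \<omega>"
  shows "br (N x) (N y) + N (N (br x y)) = N (br (N x) y + br x (N y))"
proof -
  \<comment> \<open>The co-equation at \<open>z = a\<^sub>j\<close>, with \<open>N\<close> moved off \<open>a\<^sub>j\<close> so that the sum over \<open>j\<close> becomes a
    value of \<open>N\<close>.\<close>
  have "\<omega> (br (N x) (a j)) y - \<omega> (br x (a j)) (N y)
      = \<omega> (br (N x) y) (a j) - \<omega> (N (br x y)) (a j)" for j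
    using coYBE_contracted[OF assms(2), of x y "a j"] by (simp add: N_self_adjoint) algebra
  then have "br (N x) (N y) = N (br x (N y)) + (N (br (N x) y) - N (N (br x y)))"
    by (simp add: YBE_contracted[OF assms(1)] N_def[of "br (N x) y"] N_def[of "N (br x y)"]
        scale_left_diff_distrib sum_subtractf)
  then show ?thesis by (simp add: N_add)
qed

end


section \<open>The Nijenhuis operator\<close>

theorem theorem5p7:
  fixes scale :: "'k::field_char_0 \<Rightarrow> 'a::ab_group_add \<Rightarrow> 'a"
    and br :: "'a \<Rightarrow> 'a \<Rightarrow> 'a"
    and \<omega> :: "'a \<Rightarrow> 'a \<Rightarrow> 'k"
    and I :: "'i set"
    and a b :: "'i \<Rightarrow> 'a"
  assumes "symplectic_left_alia_algebra scale br \<omega>"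
    and "finite I"
    and "triangular_left_alia_bialgebra scale br I a b"
    and "dual_triangular_left_alia_bialgebra scale (comult_r br I a b) \<omega>"
  shows "nijenhuis_left_alia_algebra scale br (\<lambda>x. \<Sum>i\<in>I. scale (\<omega> x (a i)) (b i))"
proof -
  interpret symplectic_left_alia_algebra scale br \<omega> by fact
  interpret T: symplectic_left_alia_algebra_tensor scale br \<omega> I a b
    using assms(3) by unfold_locales (simp add: triangular_left_alia_bialgebra_def)
  have "left_alia_YBE scale br I a b" and "co_left_alia_YBE (comult_r br I a b) \<omega>"
    using assms(3,4)
    by (simp_all add: triangular_left_alia_bialgebra_def dual_triangular_left_alia_bialgebra_def)
  then have "nijenhuis_left_alia_algebra scale br T.N"
    by (intro nijenhuis_left_alia_algebra.intro nijenhuis_left_alia_algebra_axioms.intro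
        left_alia_algebra_axioms T.linear_N T.nijenhuis_N)
  then show ?thesis by (simp add: T.N_def[abs_def])
qed

end
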